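(* For any finite group $G$, the minimum degree of the enhanced power graph satisfies $\delta(\mathcal{P}_e(G)) = m-1$, where $m$ is the order of a smallest maximal cyclic subgroup of $G$.
   Context: The enhanced power graph $\mathcal{P}_e(G)$ of a group $G$ is the simple undirected graph with vertex set $G$ in which two distinct vertices are adjacent if and only if they belong to a common cyclic subgroup of $G$. A maximal cyclic subgroup of $G$ is a cyclic subgroup not properly contained in any other cyclic subgroup of $G$. $\delta(\Gamma)$ denotes the minimum of the degrees of the vertices of a graph $\Gamma$. *)

theory Defs
  imports "HOL-Algebra.Elementary_Groups" "Graph_Theory.Digraph"
begin

definition cyclic_subgroup :: "'a set \<Rightarrow> ('a, 'b) monoid_scheme \<Rightarrow> bool" where
  "cyclic_subgroup C G \<longleftrightarrow> subgroup C G \<and> cyclic_group (G\<lparr>carrier := C\<rparr>)"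

definition maximal_cyclic_subgroup :: "'a set \<Rightarrow> ('a, 'b) monoid_scheme \<Rightarrow> bool" where
  "maximal_cyclic_subgroup M G \<longleftrightarrow>
     cyclic_subgroup M G \<and> \<not> (\<exists>C. cyclic_subgroup C G \<and> M \<subset> C)"

text \<open>
  Following the library, an undirected simple graph is a symmetric loop-free digraph without
  parallel arcs: an edge between x and y is the pair of arcs (x, y) and (y, x).
\<close>

definition enhanced_power_graph :: "('a, 'b) monoid_scheme \<Rightarrow> ('a, 'a \<times> 'a) pre_digraph" where
  "enhanced_power_graph G =
     \<lparr> verts = carrier G,
       arcs = {(x, y). x \<in> carrier G \<and> y \<in> carrier G \<and> x \<noteq> y \<and>
                       (\<exists>C. cyclic_subgroup C G \<and> x \<in> C \<and> y \<in> C)},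
       tail = fst, head = snd \<rparr>"

lemma graph_enhanced_power_graph:
  assumes "finite (carrier G)"
  shows "graph (enhanced_power_graph G)"
proof -
  have "finite (arcs (enhanced_power_graph G))"
    by (rule finite_subset[of _ "carrier G \<times> carrier G"])
       (use assms in \<open>auto simp: enhanced_power_graph_def\<close>)
  then show ?thesis
    by unfold_locales
       (use assms in \<open>auto simp: enhanced_power_graph_def arc_to_ends_def symmetric_conv\<close>)
qed

text \<open>
  In a symmetric digraph without parallel arcs, the out-degree of a vertex is its degree in the
  undirected graph. The minimum is meaningful only for a finite nonempty vertex set.
\<close>

definition min_degree :: "('a, 'b) pre_digraph \<Rightarrow> nat" where
  "min_degree \<Gamma> = Min (out_degree \<Gamma> ` verts \<Gamma>)"

end

theory Submission
  imports Defs
begin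

text \<open>
  A vertex \<open>x\<close> lies in some maximal cyclic subgroup \<open>M\<close> and is adjacent to every other element
  of \<open>M\<close>, so its degree is at least \<open>|M| - 1\<close>. Conversely, any cyclic subgroup containing a
  generator \<open>g\<close> of a maximal cyclic subgroup \<open>M\<close> contains \<open>M\<close> and hence equals \<open>M\<close>, so the
  degree of \<open>g\<close> is exactly \<open>|M| - 1\<close>.
\<close>

text \<open>Integer powers taken in a subgroup agree with those taken in \<open>G\<close>, so a
  cyclic generator of the restricted structure also generates the same set inside
  \<open>G\<close>.\<close>

lemma (in group) cyclic_subgroup_iff_generate:
  "cyclic_subgroup C G \<longleftrightarrow> (\<exists>x\<in>carrier G. C = generate G {x})"
proof -
  have cyclic: "cyclic_group (G\<lparr>carrier := H\<rparr>) \<longleftrightarrow> (\<exists>x\<in>H. H = generate G {x})"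
    if H: "subgroup H G" for H
  proof -
    have "range (\<lambda>n::int. x [^]\<^bsub>G\<lparr>carrier := H\<rparr>\<^esub> n) = generate G {x}" if "x \<in> H" for x
      using generate_pow[of x] int_pow_consistent[OF H that] subgroup.mem_carrier[OF H that]
      by auto
    then show ?thesis
      using group.cyclic_group[OF subgroup_imp_group[OF H]] by simp
  qed
  show ?thesis
  proof
    assume "cyclic_subgroup C G"
    then show "\<exists>x\<in>carrier G. C = generate G {x}"
      using cyclic[of C] subgroup.mem_carrier[of C G] by (auto simp: cyclic_subgroup_def)
  next
    assume "\<exists>x\<in>carrier G. C = generate G {x}"
    then obtain x where x: "x \<in> carrier G" "C = generate G {x}" by blast
    then have "subgroup C G" "x \<in> C"
      using generate_is_subgroup[of "{x}"] generate.incl[of x "{x}" G] by auto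
    with x show "cyclic_subgroup C G"
      using cyclic[of C] by (auto simp: cyclic_subgroup_def)
  qed
qed

lemma cyclic_subgroup_subset: "cyclic_subgroup C G \<Longrightarrow> C \<subseteq> carrier G"
  by (simp add: cyclic_subgroup_def subgroup.subset)

text \<open>The cyclic subgroups form a finite family inside \<open>Pow (carrier G)\<close>, so each
  lies below a member maximal for inclusion.\<close>

lemma cyclic_subgroup_le_maximal:
  assumes "finite (carrier G)" and "cyclic_subgroup C G"
  obtains M where "maximal_cyclic_subgroup M G" and "C \<subseteq> M"
proof -
  have "finite {D. cyclic_subgroup D G}"
    using assms(1) cyclic_subgroup_subset[of _ G]
    by (auto intro: finite_subset[of _ "Pow (carrier G)"])
  from finite_has_maximal2[OF this, of C] assms(2)
  obtain M where "cyclic_subgroup M G" "C \<subseteq> M" "\<forall>D. cyclic_subgroup D G \<longrightarrow> M \<subseteq> D \<longrightarrow> M = D"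
    by auto
  then show ?thesis
    using that[of M] by (auto simp: maximal_cyclic_subgroup_def)
qed

text \<open>The arcs leaving \<open>x\<close> are the pairs \<open>(x, y)\<close> with
  \<open>y\<close> a neighbour, and \<open>Pair x\<close> is injective. Degree questions thus become
  questions about cardinalities of unions of cyclic subgroups.\<close>

lemma out_degree_enhanced_power_graph:
  assumes "x \<in> carrier G"
  shows "out_degree (enhanced_power_graph G) x = card (\<Union>{C. cyclic_subgroup C G \<and> x \<in> C} - {x})"
proof -
  have "out_arcs (enhanced_power_graph G) x =
      Pair x ` (\<Union>{C. cyclic_subgroup C G \<and> x \<in> C} - {x})"
    using assms cyclic_subgroup_subset[of _ G]
    by (auto simp: out_arcs_def enhanced_power_graph_def image_iff)
  then show ?thesis
    by (simp add: out_degree_def card_image inj_on_def)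
qed

theorem theorem3p2:
  fixes G :: "('a, 'b) monoid_scheme"
  assumes "group G" and "finite (carrier G)"
  shows "int (min_degree (enhanced_power_graph G)) =
           int (Min {order (G\<lparr>carrier := M\<rparr>) | M. maximal_cyclic_subgroup M G}) - 1"
proof -
  interpret group G by (rule assms(1))
  let ?deg = "out_degree (enhanced_power_graph G)"
  let ?orders = "{order (G\<lparr>carrier := M\<rparr>) | M. maximal_cyclic_subgroup M G}"
  have sub: "M \<subseteq> carrier G" if "maximal_cyclic_subgroup M G" for M
    using that cyclic_subgroup_subset by (auto simp: maximal_cyclic_subgroup_def)
  \<comment> \<open>The \<open>+ 1\<close> on the degree side avoids truncated subtraction on
    \<open>nat\<close>.\<close>
  have lower: "\<exists>M. maximal_cyclic_subgroup M G \<and> card M \<le> ?deg x + 1"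
    if x: "x \<in> carrier G" for x
  proof -
    have "cyclic_subgroup (generate G {x}) G"
      using x cyclic_subgroup_iff_generate by blast
    then obtain M where M: "maximal_cyclic_subgroup M G" "generate G {x} \<subseteq> M"
      using cyclic_subgroup_le_maximal[OF assms(2)] by blast
    have "x \<in> M"
      using M(2) generate.incl[of x "{x}" G] by auto
    let ?N = "\<Union>{C. cyclic_subgroup C G \<and> x \<in> C}"
    \<comment> \<open>Monotonicity of \<open>card\<close> requires the larger set to be
      finite.\<close>
    have "finite ?N"
      using assms(2) cyclic_subgroup_subset[of _ G] by (auto intro: finite_subset)
    moreover have "M \<subseteq> ?N"
      using M(1) \<open>x \<in> M\<close> by (auto simp: maximal_cyclic_subgroup_def)
    ultimately have "card (M - {x}) \<le> card (?N - {x})"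
      by (intro card_mono) auto
    then show ?thesis
      using M(1) \<open>x \<in> M\<close> x by (auto simp: out_degree_enhanced_power_graph)
  qed
  have attained: "\<exists>g\<in>carrier G. ?deg g + 1 = card M" if M: "maximal_cyclic_subgroup M G" for M
  proof -
    obtain g where g: "g \<in> carrier G" "M = generate G {g}"
      using M cyclic_subgroup_iff_generate by (auto simp: maximal_cyclic_subgroup_def)
    have "g \<in> M"
      using g generate.incl[of g "{g}" G] by simp
    have "C = M" if "cyclic_subgroup C G" "g \<in> C" for C
      using that M g(2) generate_subgroup_incl[of "{g}" C]
      by (auto simp: maximal_cyclic_subgroup_def cyclic_subgroup_def)
    \<comment> \<open>The union in the degree formula collapses to \<open>M\<close>.\<close>
    then have "{C. cyclic_subgroup C G \<and> g \<in> C} = {M}"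
      using M \<open>g \<in> M\<close> by (auto simp: maximal_cyclic_subgroup_def)
    then have "?deg g = card (M - {g})"
      using g(1) by (simp add: out_degree_enhanced_power_graph)
    moreover have "finite M"
      using sub[OF M] assms(2) finite_subset by blast
    ultimately show ?thesis
      using g(1) \<open>g \<in> M\<close> card_Suc_Diff1[of M g] by (intro bexI[of _ g]) simp_all
  qed
  have orders: "?orders = card ` {M. maximal_cyclic_subgroup M G}"
    by (auto simp: order_def)
  have "finite ?orders"
    unfolding orders using sub assms(2)
    by (auto intro!: finite_imageI intro: finite_subset[of _ "Pow (carrier G)"])
  \<comment> \<open>\<open>Min\<close> is meaningful only on a nonempty set; \<open>lower\<close> at
    the identity supplies a maximal cyclic subgroup.\<close>
  have "?orders \<noteq> {}"
    unfolding orders using lower[OF one_closed] by auto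
  \<comment> \<open>For \<open>\<le>\<close>, \<open>attained\<close> is applied to a smallest
    maximal cyclic subgroup; for the converse, \<open>lower\<close> is applied to a vertex of least
    degree.\<close>
  have "Min (?deg ` carrier G) + 1 = Min ?orders"
  proof (rule antisym)
    have "Min ?orders \<in> ?orders"
      using Min_in \<open>finite ?orders\<close> \<open>?orders \<noteq> {}\<close> by blast
    then obtain M where "maximal_cyclic_subgroup M G" "Min ?orders = card M"
      unfolding orders by blast
    with attained obtain g where "g \<in> carrier G" "?deg g + 1 = Min ?orders"
      by metis
    moreover from this have "Min (?deg ` carrier G) \<le> ?deg g"
      using assms(2) by (intro Min_le) auto
    ultimately show "Min (?deg ` carrier G) + 1 \<le> Min ?orders"
      by linarith
  next
    have "Min (?deg ` carrier G) \<in> ?deg ` carrier G"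
      using assms(2) by (intro Min_in) auto
    then obtain x where x: "x \<in> carrier G" "Min (?deg ` carrier G) = ?deg x"
      by blast
    from lower[OF x(1)] obtain M where "maximal_cyclic_subgroup M G" "card M \<le> ?deg x + 1"
      by blast
    then show "Min ?orders \<le> Min (?deg ` carrier G) + 1"
      using x(2) Min_le[OF \<open>finite ?orders\<close>, of "card M"] unfolding orders by auto
  qed
  then show ?thesis
    by (simp add: min_degree_def enhanced_power_graph_def)
qed

end
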